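(* Let $n,m\in\mathbb{N}$ and let $S_n,T_m$ be stochastically independent isotropic random Schläfli cones in $\mathbb{R}^d$ with parameters $n$ and $m$, respectively. Then $$\mathbb{P}\{S_n\cap T_m\neq\{o\}\}=\frac{2}{C(n,d)\,C(m,d)}\sum_{k=0}^{\lfloor (d-1)/2\rfloor}\ \sum_{\substack{p,q\ge0\\ p+q=d-2k-1}}\binom{n}{p}\binom{m}{q}.$$
   Context: Work in $\mathbb{R}^d$, $d\ge2$. Binomial coefficients $\binom{n}{r}$ with $r>n$ are $0$. $C(n,d):=2\sum_{r=0}^{d-1}\binom{n-1}{r}$ is the number of Schläfli cones induced by $n$ linear hyperplanes in general position (any $k\le d$ of them meet in a $(d-k)$-dimensional subspace); the Schläfli cones are the closures of the connected components of the complement of the union of the hyperplanes. The isotropic random Schläfli cone with parameter $n$ is obtained by taking $n$ independent hyperplanes $u_1^\perp,\dots,u_n^\perp$, with $u_i$ uniformly distributed on the unit sphere $\mathbb{S}^{d-1}$, and selecting one of the induced Schläfli cones uniformly at random. *)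

theory Defs
  imports "HOL-Probability.Probability"
begin

definition sphere_uniform :: "'a::euclidean_space measure" where
  "sphere_uniform = distr (uniform_measure lborel (ball 0 1)) borel (\<lambda>x. x /\<^sub>R norm x)"

definition schlaefli_cones :: "nat \<Rightarrow> (nat \<Rightarrow> 'a::euclidean_space) \<Rightarrow> 'a set set" where
  "schlaefli_cones n u =
     closure ` components (- (\<Union>i<n. {x. u i \<bullet> x = 0}))"

definition C_num :: "nat \<Rightarrow> nat \<Rightarrow> nat" where
  "C_num n d = 2 * (\<Sum>r<d. (n - 1) choose r)"

text \<open>Probability that two independent isotropic random Schlaefli cones with
  parameters n and m intersect nontrivially: first draw the normal vectors
  independently and uniformly on the sphere, then pick one induced cone of each
  family uniformly at random (independently).\<close>
definition schlaefli_intersection_prob :: "'a::euclidean_space itself \<Rightarrow> nat \<Rightarrow> nat \<Rightarrow> real" where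
  "schlaefli_intersection_prob _ n m =
     (\<integral>u. (\<integral>v.
        real (card {(S, T). S \<in> schlaefli_cones n u \<and> T \<in> schlaefli_cones m v \<and> S \<inter> T \<noteq> {0::'a}})
        / (real (card (schlaefli_cones n u)) * real (card (schlaefli_cones m v)))
      \<partial>(PiM {..<m} (\<lambda>_. (sphere_uniform :: 'a measure))))
      \<partial>(PiM {..<n} (\<lambda>_. (sphere_uniform :: 'a measure))))"

end

theory Submission
  imports Defs
begin

text \<open>For \<open>n + m\<close> hyperplanes in general position, two closed cones, one from each arrangement, that
  share a nonzero point also have intersecting interiors, and the intersection of these interiors
  is a cell of the joint arrangement. So the number of pairs of cones meeting outside the origin
  is almost surely the constant \<open>C(n + m, d)\<close>, and the probability is
  \<open>C(n + m, d) / (C(n, d) C(m, d))\<close>. Pascal's rule turns \<open>C(n + m, d)\<close> into twice the sum of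
  every second binomial coefficient of \<open>n + m\<close>, and Vandermonde's identity splits these.\<close>

text \<open>Sign patterns carry the argument in place of the cones: they lie in a fixed finite power
  set, so a number of cones is a finite sum of indicators, measurable even on degenerate
  configurations, and patterns of the two families concatenate to patterns of the joint one. General
  position appears in two forms. The count wants dimensions of intersections, a form that survives
  restriction to a hyperplane. Probability supplies avoidance of spans: each normal lies outside the
  span of any fewer than d earlier ones. \<open>gen_posI\<close> leads from the second form to the
  first. Since the probability is an iterated integral, exceptional sets for the second family must
  be null for almost every fixed choice of the first; hence \<open>AE_notin_span\<close> carries a
  set \<open>U\<close> of vectors that are already fixed.\<close>

section \<open>Cells of a central arrangement\<close>

text \<open>A cell of the arrangement is encoded by the set \<open>\<sigma>\<close> of those indices \<open>i < n\<close> for which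
  \<open>w i \<bullet> x\<close> is positive on it. The restriction to a subspace \<open>V\<close> allows induction on the dimension.\<close>

definition cells :: "nat \<Rightarrow> (nat \<Rightarrow> 'a::euclidean_space) \<Rightarrow> 'a set \<Rightarrow> nat set set" where
  "cells n w V = {\<sigma>. \<sigma> \<subseteq> {..<n} \<and>
     (\<exists>x\<in>V. \<forall>i<n. if i \<in> \<sigma> then w i \<bullet> x > 0 else w i \<bullet> x < 0)}"

definition open_cell :: "nat \<Rightarrow> (nat \<Rightarrow> 'a::euclidean_space) \<Rightarrow> nat set \<Rightarrow> 'a set" where
  "open_cell n w \<sigma> = {x. \<forall>i<n. if i \<in> \<sigma> then w i \<bullet> x > 0 else w i \<bullet> x < 0}"

definition closed_cell :: "nat \<Rightarrow> (nat \<Rightarrow> 'a::euclidean_space) \<Rightarrow> nat set \<Rightarrow> 'a set" where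
  "closed_cell n w \<sigma> = {x. \<forall>i<n. if i \<in> \<sigma> then w i \<bullet> x \<ge> 0 else w i \<bullet> x \<le> 0}"

definition flat :: "(nat \<Rightarrow> 'a::euclidean_space) \<Rightarrow> nat set \<Rightarrow> 'a set" where
  "flat w J = {x. \<forall>j\<in>J. w j \<bullet> x = 0}"

lemma subspace_flat: "subspace (flat w J)"
  by (auto simp: flat_def subspace_def inner_add_right)

text \<open>Truncated subtraction expresses that too many hyperplanes meet only in the origin.\<close>

definition gen_pos :: "nat \<Rightarrow> (nat \<Rightarrow> 'a::euclidean_space) \<Rightarrow> 'a set \<Rightarrow> bool" where
  "gen_pos n w V \<longleftrightarrow> (\<forall>J\<subseteq>{..<n}. dim (V \<inter> flat w J) = dim V - card J)"

lemma cells_UNIV: "cells n w UNIV = {\<sigma>. \<sigma> \<subseteq> {..<n} \<and> open_cell n w \<sigma> \<noteq> {}}"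
  by (auto simp: cells_def open_cell_def)

section \<open>Perturbing points into open cells\<close>

lemma perturb_sign:
  fixes a b :: real
  assumes "if s then a > 0 else a < 0"
  shows "\<forall>\<^sub>F e in at_right 0. if s then a + e * b > 0 else a + e * b < 0"
proof -
  have lim: "((\<lambda>e. a + e * b) \<longlongrightarrow> a + 0 * b) (at_right 0)"
    by (intro tendsto_intros)
  show ?thesis
  proof (cases s)
    case True
    with assms lim have "\<forall>\<^sub>F e in at_right 0. a + e * b > 0"
      by (intro order_tendstoD) auto
    with True show ?thesis by simp
  next
    case False
    with assms lim have "\<forall>\<^sub>F e in at_right 0. a + e * b < 0"
      by (intro order_tendstoD) auto
    with False show ?thesis by simp
  qed
qed

text \<open>Signs are decided lexicographically: for small e > 0 the value at x fixes the sign
  unless it vanishes, and then y decides. Finitely many conditions leave a common range of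
  e.\<close>

lemma perturb_cell:
  fixes w :: "nat \<Rightarrow> 'a::euclidean_space"
  assumes "\<And>i. i < n \<Longrightarrow> if i \<in> \<sigma> then w i \<bullet> x > 0 \<or> w i \<bullet> x = 0 \<and> w i \<bullet> y > 0
                                  else w i \<bullet> x < 0 \<or> w i \<bullet> x = 0 \<and> w i \<bullet> y < 0"
  shows "\<forall>\<^sub>F e in at_right 0. x + e *\<^sub>R y \<in> open_cell n w \<sigma>"
proof -
  have pos: "\<forall>\<^sub>F e in at_right 0. e > (0::real)"
    by (rule eventually_at_right_less)
  have "\<forall>\<^sub>F e in at_right 0. if i \<in> \<sigma> then w i \<bullet> (x + e *\<^sub>R y) > 0 else w i \<bullet> (x + e *\<^sub>R y) < 0"
    if "i < n" for i
  proof (cases "w i \<bullet> x = 0")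
    case True
    then have "if i \<in> \<sigma> then w i \<bullet> y > 0 else w i \<bullet> y < 0"
      using assms[OF that] by (simp split: if_splits)
    with True show ?thesis
      by (intro eventually_mono[OF pos]) (simp add: inner_add_right mult_pos_neg split: if_splits)
  next
    case False
    then have "if i \<in> \<sigma> then w i \<bullet> x > 0 else w i \<bullet> x < 0"
      using assms[OF that] by (auto split: if_splits)
    from perturb_sign[OF this, of "w i \<bullet> y"] show ?thesis
      by (simp only: inner_add_right inner_scaleR_right)
  qed
  then have "\<forall>\<^sub>F e in at_right 0. \<forall>i\<in>{..<n}. if i \<in> \<sigma> then w i \<bullet> (x + e *\<^sub>R y) > 0 else w i \<bullet> (x + e *\<^sub>R y) < 0"
    by (intro eventually_ball_finite) auto
  then show ?thesis by (rule eventually_mono) (auto simp: open_cell_def)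
qed

lemma ex_perturb_cell:
  fixes w :: "nat \<Rightarrow> 'a::euclidean_space"
  assumes "\<And>i. i < n \<Longrightarrow> if i \<in> \<sigma> then w i \<bullet> x > 0 \<or> w i \<bullet> x = 0 \<and> w i \<bullet> y > 0
                                  else w i \<bullet> x < 0 \<or> w i \<bullet> x = 0 \<and> w i \<bullet> y < 0"
  shows "\<exists>e. e > 0 \<and> x + e *\<^sub>R y \<in> open_cell n w \<sigma>"
  using eventually_happens'[OF _ eventually_conj[OF eventually_at_right_less[of 0] perturb_cell[OF assms]]]
  by simp

lemma open_cell_subset_closed_cell: "open_cell n w \<sigma> \<subseteq> closed_cell n w \<sigma>"
  by (force simp: open_cell_def closed_cell_def split: if_splits)

lemma closed_closed_cell: "closed (closed_cell n w \<sigma>)"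
proof -
  have "closed_cell n w \<sigma> = (\<Inter>i\<in>{..<n}. if i \<in> \<sigma> then {x. w i \<bullet> x \<ge> 0} else {x. w i \<bullet> x \<le> 0})"
    by (auto simp: closed_cell_def split: if_splits)
  then show ?thesis
    by (simp only:) (intro closed_INT, simp add: closed_halfspace_le closed_halfspace_ge)
qed

text \<open>A point of the closed cell is approached along the segment towards any point of the open
  cell. Nonemptiness matters: a closed cell always contains the origin.\<close>

lemma closure_open_cell:
  assumes "open_cell n w \<sigma> \<noteq> {}"
  shows "closure (open_cell n w \<sigma>) = closed_cell n w \<sigma>"
proof
  show "closure (open_cell n w \<sigma>) \<subseteq> closed_cell n w \<sigma>"
    by (intro closure_minimal open_cell_subset_closed_cell closed_closed_cell)
  show "closed_cell n w \<sigma> \<subseteq> closure (open_cell n w \<sigma>)"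
  proof
    fix x assume x: "x \<in> closed_cell n w \<sigma>"
    from assms obtain y where y: "y \<in> open_cell n w \<sigma>" by auto
    have *: "if i \<in> \<sigma> then w i \<bullet> x > 0 \<or> w i \<bullet> x = 0 \<and> w i \<bullet> y > 0
          else w i \<bullet> x < 0 \<or> w i \<bullet> x = 0 \<and> w i \<bullet> y < 0" if "i < n" for i
      using x y that by (auto simp: open_cell_def closed_cell_def split: if_splits dest!: spec[of _ i])
    have "\<forall>\<^sub>F e in at_right 0. x + e *\<^sub>R y \<in> closure (open_cell n w \<sigma>)"
      by (rule eventually_mono[OF perturb_cell[of n]], erule *) (rule subsetD[OF closure_subset])
    moreover have "((\<lambda>e. x + e *\<^sub>R y) \<longlongrightarrow> x + 0 *\<^sub>R y) (at_right 0)"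
      by (intro tendsto_intros)
    ultimately show "x \<in> closure (open_cell n w \<sigma>)"
      using Lim_in_closed_set[of "closure (open_cell n w \<sigma>)" "\<lambda>e. x + e *\<^sub>R y" "at_right 0" x] by simp
  qed
qed

section \<open>Components of the complement, and the Schlaefli cones, as cells\<close>

lemma open_cell_eq_INT:
  "open_cell n w \<sigma> = (\<Inter>i\<in>{..<n}. if i \<in> \<sigma> then {x. w i \<bullet> x > 0} else {x. w i \<bullet> x < 0})"
  by (auto simp: open_cell_def split: if_splits)

lemma open_open_cell: "open (open_cell n w \<sigma>)"
  unfolding open_cell_eq_INT
  by (intro open_INT) (auto simp: open_halfspace_lt open_halfspace_gt)

lemma convex_open_cell: "convex (open_cell n w \<sigma>)"
  unfolding open_cell_eq_INT
  by (intro convex_INT) (simp add: convex_halfspace_lt convex_halfspace_gt)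

text \<open>Cells are convex, hence connected. On a connected set that avoids the hyperplanes each
  linear form has an interval as image that misses 0, so its sign is constant; thus cells are
  maximal. Every component contains a point and so equals the cell of that point.\<close>

lemma components_arrangement:
  fixes w :: "nat \<Rightarrow> 'a::euclidean_space"
  shows "components (- (\<Union>i<n. {x. w i \<bullet> x = 0})) = open_cell n w ` cells n w UNIV"
    (is "components ?A = _")
proof
  have comp: "open_cell n w \<sigma> \<in> components ?A" if "\<sigma> \<in> cells n w UNIV" for \<sigma>
  proof -
    have ne: "open_cell n w \<sigma> \<noteq> {}"
      using that by (simp add: cells_UNIV)
    have sub: "open_cell n w \<sigma> \<subseteq> ?A"
      by (force simp: open_cell_def split: if_splits)
    have "D = open_cell n w \<sigma>" if D: "open_cell n w \<sigma> \<subseteq> D" "D \<subseteq> ?A" "connected D" for D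
    proof -
      obtain x where x: "x \<in> open_cell n w \<sigma>" using ne by auto
      have "y \<in> open_cell n w \<sigma>" if y: "y \<in> D" for y
        unfolding open_cell_def
      proof (intro CollectI allI impI)
        fix i assume i: "i < n"
        have "is_interval ((\<lambda>z. w i \<bullet> z) ` D)"
          unfolding is_interval_connected_1
          by (intro connected_continuous_image D continuous_intros)
        moreover have "0 \<notin> (\<lambda>z. w i \<bullet> z) ` D"
          using D(2) i by auto
        moreover have "w i \<bullet> x \<in> (\<lambda>z. w i \<bullet> z) ` D" "w i \<bullet> y \<in> (\<lambda>z. w i \<bullet> z) ` D"
          using x y D(1) by auto
        ultimately have "\<not> (w i \<bullet> x \<le> 0 \<and> 0 \<le> w i \<bullet> y)" "\<not> (w i \<bullet> y \<le> 0 \<and> 0 \<le> w i \<bullet> x)"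
          by (metis mem_is_interval_1_I)+
        then show "if i \<in> \<sigma> then w i \<bullet> y > 0 else w i \<bullet> y < 0"
          using x i by (auto simp: open_cell_def split: if_splits)
      qed
      with D(1) show ?thesis by auto
    qed
    then show ?thesis
      unfolding in_components_maximal
      by (intro conjI ne sub convex_connected[OF convex_open_cell]) auto
  qed
  then show "open_cell n w ` cells n w UNIV \<subseteq> components ?A" by auto
  show "components ?A \<subseteq> open_cell n w ` cells n w UNIV"
  proof
    fix D assume D: "D \<in> components ?A"
    then obtain x where x: "x \<in> D" "x \<in> ?A"
      using in_components_nonempty[OF D] in_components_subset[OF D] by blast
    define \<sigma> where "\<sigma> = {i. i < n \<and> w i \<bullet> x > 0}"
    have xs: "x \<in> open_cell n w \<sigma>"
      using x(2) by (auto simp: open_cell_def \<sigma>_def not_less order_less_le)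
    then have s: "\<sigma> \<in> cells n w UNIV"
      by (auto simp: cells_UNIV \<sigma>_def)
    have "D = open_cell n w \<sigma>"
      using components_nonoverlap[OF D comp[OF s]] x(1) xs by (metis IntI empty_iff)
    with s show "D \<in> open_cell n w ` cells n w UNIV" by blast
  qed
qed

lemma schlaefli_cones_eq: "schlaefli_cones n w = closed_cell n w ` cells n w UNIV"
  unfolding schlaefli_cones_def components_arrangement image_image
  by (rule image_cong) (auto simp: cells_UNIV closure_open_cell)

lemma inj_on_closed_cell: "inj_on (closed_cell n w) (cells n w UNIV)"
proof (rule inj_onI)
  fix \<sigma> \<tau> assume st: "\<sigma> \<in> cells n w UNIV" "\<tau> \<in> cells n w UNIV" "closed_cell n w \<sigma> = closed_cell n w \<tau>"
  then obtain x y where x: "x \<in> open_cell n w \<sigma>" and y: "y \<in> open_cell n w \<tau>"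
    by (auto simp: cells_UNIV)
  have "x \<in> closed_cell n w \<tau>" using x open_cell_subset_closed_cell st(3) by blast
  then have "i \<in> \<sigma> \<longleftrightarrow> i \<in> \<tau>" if "i < n" for i
    using x that by (auto simp: open_cell_def closed_cell_def not_le dest!: spec[of _ i] split: if_splits)
  then show "\<sigma> = \<tau>" using st(1,2) by (auto simp: cells_def)
qed

lemma card_schlaefli_cones: "card (schlaefli_cones n w) = card (cells n w UNIV)"
  by (simp add: schlaefli_cones_eq card_image inj_on_closed_cell)

text \<open>The origin lies in every closed cell, so an intersection different from {0} is one with
  a nonzero point, never the empty set.\<close>

lemma card_meeting_pairs:
  "card {(S, T). S \<in> schlaefli_cones n u \<and> T \<in> schlaefli_cones m v \<and> S \<inter> T \<noteq> {0}}
   = card {(\<sigma>, \<tau>). \<sigma> \<in> cells n u UNIV \<and> \<tau> \<in> cells m v UNIV \<and>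
        (\<exists>x. x \<noteq> 0 \<and> x \<in> closed_cell n u \<sigma> \<and> x \<in> closed_cell m v \<tau>)}" (is "card ?L = card ?R")
proof -
  have ne: "(\<exists>x. x \<noteq> 0 \<and> x \<in> closed_cell n u \<sigma> \<and> x \<in> closed_cell m v \<tau>)
    \<longleftrightarrow> closed_cell n u \<sigma> \<inter> closed_cell m v \<tau> \<noteq> {0}" for \<sigma> \<tau>
  proof -
    have "0 \<in> closed_cell n u \<sigma>" "0 \<in> closed_cell m v \<tau>" by (auto simp: closed_cell_def)
    then show ?thesis by blast
  qed
  have "?L = map_prod (closed_cell n u) (closed_cell m v) ` ?R"
  proof (intro set_eqI iffI)
    fix z assume "z \<in> ?L"
    then obtain \<sigma> \<tau> where "z = (closed_cell n u \<sigma>, closed_cell m v \<tau>)" "(\<sigma>, \<tau>) \<in> ?R"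
      unfolding schlaefli_cones_eq ne by blast
    then show "z \<in> map_prod (closed_cell n u) (closed_cell m v) ` ?R" by force
  next
    fix z assume "z \<in> map_prod (closed_cell n u) (closed_cell m v) ` ?R"
    then show "z \<in> ?L" unfolding schlaefli_cones_eq ne by auto
  qed
  moreover have "inj_on (map_prod (closed_cell n u) (closed_cell m v)) ?R"
    by (rule inj_on_subset[OF map_prod_inj_on[OF inj_on_closed_cell inj_on_closed_cell]]) auto
  ultimately show ?thesis by (simp add: card_image)
qed

section \<open>Counting cells in general position\<close>

lemma dim_Int_hyperplane:
  fixes V :: "'a::euclidean_space set"
  assumes V: "subspace V" and x: "x \<in> V" "a \<bullet> x \<noteq> 0"
  shows "dim V = Suc (dim (V \<inter> {x. a \<bullet> x = 0}))"
proof -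
  let ?W = "V \<inter> {x. a \<bullet> x = 0}"
  have W: "subspace ?W"
    by (intro subspace_inter V subspace_hyperplane)
  have "V \<subseteq> span (insert x ?W)"
  proof
    fix y assume y: "y \<in> V"
    let ?k = "(a \<bullet> y) / (a \<bullet> x)"
    have "y - ?k *\<^sub>R x \<in> ?W"
      using V x y by (auto simp: subspace_diff subspace_scale inner_diff_right)
    then show "y \<in> span (insert x ?W)"
      by (auto simp: span_breakdown_eq intro!: exI[of _ ?k] span_base)
  qed
  moreover have "insert x ?W \<subseteq> V" using x by auto
  ultimately have "dim V = dim (insert x ?W)"
    by (metis dim_span dim_subset dual_order.antisym)
  also have "\<dots> = Suc (dim ?W)"
    using x(2) W by (simp add: dim_insert span_eq_iff[THEN iffD2])
  finally show ?thesis .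
qed

lemma flat_insert: "flat w (insert i J) = {x. w i \<bullet> x = 0} \<inter> flat w J"
  by (auto simp: flat_def)

text \<open>Hyperplanes are added in increasing order of index, which matches normals drawn one
  after another. Each lowers the dimension by one until the intersection is {0}, where truncated
  subtraction takes over.\<close>

lemma gen_posI:
  fixes w :: "nat \<Rightarrow> 'a::euclidean_space"
  assumes "\<And>i J. i < n \<Longrightarrow> J \<subseteq> {..<i} \<Longrightarrow> card J < DIM('a) \<Longrightarrow> w i \<notin> span (w ` J)"
  shows "gen_pos n w UNIV"
proof -
  have "dim (flat w J) = DIM('a) - card J" if "J \<subseteq> {..<k}" "k \<le> n" for J k
    using that
  proof (induction k arbitrary: J)
    case 0
    then show ?case by (simp add: flat_def)
  next
    case (Suc k)
    show ?case
    proof (cases "k \<in> J")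
      case False
      with Suc.prems have "J \<subseteq> {..<k}" by (auto simp: less_Suc_eq)
      with Suc show ?thesis by simp
    next
      case True
      define J' where "J' = J - {k}"
      have J': "J = insert k J'" "k \<notin> J'" "J' \<subseteq> {..<k}"
        using True Suc.prems by (auto simp: J'_def less_Suc_eq)
      have fin: "finite J'" using J'(3) finite_subset by blast
      have IH: "dim (flat w J') = DIM('a) - card J'"
        using Suc J' by simp
      have card: "card J = Suc (card J')" using J' fin by simp
      show ?thesis
      proof (cases "card J' < DIM('a)")
        case True
        then have ns: "w k \<notin> span (w ` J')"
          using assms[of k J'] Suc.prems J' by simp
        \<comment> \<open>The part \<open>z\<close> of \<open>w k\<close> orthogonal to the earlier
          normals lies in their flat, but off the new hyperplane because
          \<open>w k \<bullet> z = z \<bullet> z\<close>. It witnesses the drop in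
          dimension.\<close>
        obtain y z where yz: "y \<in> span (w ` J')" "\<And>v. v \<in> span (w ` J') \<Longrightarrow> orthogonal z v" "w k = y + z"
          using orthogonal_subspace_decomp_exists[of "w ` J'" "w k"] by metis
        have zf: "z \<in> flat w J'"
          using yz(2) by (simp add: flat_def orthogonal_def inner_commute[of "w _" z] span_base)
        have "w k \<bullet> z = z \<bullet> z"
          using yz(2)[OF yz(1)] by (simp add: yz(3) inner_add_left orthogonal_def inner_commute[of y z])
        moreover have "z \<noteq> 0" using ns yz by auto
        ultimately have "w k \<bullet> z \<noteq> 0" by simp
        from dim_Int_hyperplane[OF subspace_flat zf this] show ?thesis
          using IH card by (simp add: J'(1) flat_insert Int_commute)
      next
        case False
        with IH have "flat w J' \<subseteq> {0}" by (simp only: dim_eq_0[symmetric])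
        then have "flat w J \<subseteq> {0}" by (auto simp: J' flat_insert)
        then have "dim (flat w J) = 0" by (simp only: dim_eq_0)
        with False card show ?thesis by simp
      qed
    qed
  qed
  then show ?thesis by (auto simp: gen_pos_def)
qed

lemma gen_pos_mono: "gen_pos n w V \<Longrightarrow> k \<le> n \<Longrightarrow> gen_pos k w V"
  unfolding gen_pos_def by (meson lessThan_subset_iff order_trans)

text \<open>Truncated subtraction composes, (D - 1) - c = D - (c + 1), so dimensions already
  exhausted need no separate case.\<close>

lemma gen_pos_Int_hyperplane:
  assumes "gen_pos (Suc n) w V"
  shows "gen_pos n w (V \<inter> {x. w n \<bullet> x = 0})"
  unfolding gen_pos_def
proof (intro allI impI)
  fix J assume J: "J \<subseteq> {..<n}"
  then have fin: "finite J" and n: "n \<notin> J" using finite_subset by auto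
  have "dim (V \<inter> flat w (insert n J)) = dim V - Suc (card J)"
    using assms[unfolded gen_pos_def, rule_format, of "insert n J"] J fin n by (auto simp: lessThan_Suc)
  moreover have "dim (V \<inter> flat w {n}) = dim V - 1"
    using assms[unfolded gen_pos_def, rule_format, of "{n}"] by auto
  ultimately show "dim (V \<inter> {x. w n \<bullet> x = 0} \<inter> flat w J) = dim (V \<inter> {x. w n \<bullet> x = 0}) - card J"
    by (simp add: flat_insert Int_assoc flat_def[of w "{}"])
qed

text \<open>Deletion and restriction: the cells cut into two by the new hyperplane correspond to the
  cells that the old hyperplanes induce in it.\<close>

lemma card_cells_Suc:
  fixes w :: "nat \<Rightarrow> 'a::euclidean_space"
  assumes V: "subspace V" and z: "z \<in> V" "w n \<bullet> z \<noteq> 0"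
  shows "card (cells (Suc n) w V) = card (cells n w V) + card (cells n w (V \<inter> {x. w n \<bullet> x = 0}))"
proof -
  \<comment> \<open>\<open>P\<close> and \<open>N\<close> collect the old patterns realized on the
    positive and on the negative side of the new hyperplane. Their union is all old cells, their
    intersection the cells cut in two, and the new cells are a disjoint copy of both.\<close>
  define P where "P = {\<sigma>. \<sigma> \<subseteq> {..<n} \<and> (\<exists>x\<in>V. w n \<bullet> x > 0 \<and> x \<in> open_cell n w \<sigma>)}"
  define N where "N = {\<sigma>. \<sigma> \<subseteq> {..<n} \<and> (\<exists>x\<in>V. w n \<bullet> x < 0 \<and> x \<in> open_cell n w \<sigma>)}"
  have cells: "cells n w U = {\<sigma>. \<sigma> \<subseteq> {..<n} \<and> (\<exists>x\<in>U. x \<in> open_cell n w \<sigma>)}" for U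
    by (simp add: cells_def open_cell_def)
  have fin: "finite P" "finite N"
    unfolding P_def N_def by (rule finite_subset[of _ "Pow {..<n}"]; auto)+
  have push: "\<exists>x'\<in>V. w n \<bullet> x' > 0 \<and> x' \<in> open_cell n w \<sigma>" "\<exists>x'\<in>V. w n \<bullet> x' < 0 \<and> x' \<in> open_cell n w \<sigma>"
    if x: "x \<in> V" "x \<in> open_cell n w \<sigma>" "w n \<bullet> x = 0" for x \<sigma>
  proof -
    have *: "\<exists>e>0. x + e *\<^sub>R y \<in> open_cell n w \<sigma>" for y
      using x(2) by (intro ex_perturb_cell) (auto simp: open_cell_def)
    \<comment> \<open>The sign factor orients \<open>z\<close> towards the positive side, so one
      vector and its negative serve both directions.\<close>
    define y where "y = sgn (w n \<bullet> z) *\<^sub>R z"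
    have y: "y \<in> V" "w n \<bullet> y > 0" using V z by (auto simp: y_def subspace_scale sgn_if)
    obtain e where "e > 0" "x + e *\<^sub>R y \<in> open_cell n w \<sigma>" using * by blast
    moreover have "x + e *\<^sub>R y \<in> V" using V x y by (simp add: subspace_add subspace_scale)
    moreover have "w n \<bullet> (x + e *\<^sub>R y) > 0" if "e > 0" using x y that by (simp add: inner_add_right)
    ultimately show "\<exists>x'\<in>V. w n \<bullet> x' > 0 \<and> x' \<in> open_cell n w \<sigma>" by blast
    obtain e where "e > 0" "x + e *\<^sub>R (- y) \<in> open_cell n w \<sigma>" using * by blast
    moreover have "x + e *\<^sub>R (- y) \<in> V" using V x y by (simp add: subspace_diff subspace_scale)
    moreover have "w n \<bullet> (x + e *\<^sub>R (- y)) < 0" if "e > 0" using x y that by (simp add: inner_diff_right)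
    ultimately show "\<exists>x'\<in>V. w n \<bullet> x' < 0 \<and> x' \<in> open_cell n w \<sigma>" by blast
  qed
  have union: "P \<union> N = cells n w V"
  proof (intro equalityI subsetI)
    fix \<sigma> assume "\<sigma> \<in> cells n w V"
    then obtain x where x: "\<sigma> \<subseteq> {..<n}" "x \<in> V" "x \<in> open_cell n w \<sigma>" by (auto simp: cells)
    consider "w n \<bullet> x > 0" | "w n \<bullet> x < 0" | "w n \<bullet> x = 0" by linarith
    then show "\<sigma> \<in> P \<union> N"
      by cases (use x push(1)[OF x(2,3)] in \<open>auto simp: P_def N_def\<close>)
  qed (auto simp: P_def N_def cells)
  have inter: "P \<inter> N = cells n w (V \<inter> {x. w n \<bullet> x = 0})"
  proof (intro equalityI subsetI)
    fix \<sigma> assume "\<sigma> \<in> cells n w (V \<inter> {x. w n \<bullet> x = 0})"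
    then obtain x where x: "\<sigma> \<subseteq> {..<n}" "x \<in> V" "x \<in> open_cell n w \<sigma>" "w n \<bullet> x = 0" by (auto simp: cells)
    then show "\<sigma> \<in> P \<inter> N"
      using push[OF x(2-4)] by (simp add: P_def N_def)
  next
    fix \<sigma> assume "\<sigma> \<in> P \<inter> N"
    then obtain x y where x: "x \<in> V" "w n \<bullet> x > 0" "x \<in> open_cell n w \<sigma>"
      and y: "y \<in> V" "w n \<bullet> y < 0" "y \<in> open_cell n w \<sigma>" and \<sigma>: "\<sigma> \<subseteq> {..<n}"
      by (auto simp: P_def N_def)
    define s where "s = w n \<bullet> x - w n \<bullet> y"
    have s: "s > 0" using x y by (simp add: s_def)
    \<comment> \<open>The weights at which the segment from \<open>x\<close> to \<open>y\<close>
      crosses the hyperplane; by convexity the crossing point is still in the cell.\<close>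
    define a where "a = - (w n \<bullet> y) / s"
    define b where "b = w n \<bullet> x / s"
    have ab: "a \<ge> 0" "b \<ge> 0" "a + b = 1"
      using s x y by (auto simp: a_def b_def field_simps) (simp add: s_def)
    let ?z = "a *\<^sub>R x + b *\<^sub>R y"
    have "?z \<in> open_cell n w \<sigma>"
      using convex_open_cell[of n w \<sigma>] x(3) y(3) ab unfolding convex_def by blast
    moreover have "?z \<in> V" using V x y by (simp add: subspace_add subspace_scale)
    moreover have "w n \<bullet> ?z = 0"
      using s by (simp add: inner_add_right inner_diff_right a_def b_def)
    ultimately show "\<sigma> \<in> cells n w (V \<inter> {x. w n \<bullet> x = 0})"
      using \<sigma> by (auto simp: cells)
  qed
  have split: "cells (Suc n) w V = insert n ` P \<union> N"
  proof (intro equalityI subsetI)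
    fix \<sigma> assume "\<sigma> \<in> cells (Suc n) w V"
    then obtain x where x: "\<sigma> \<subseteq> {..<Suc n}" "x \<in> V" "x \<in> open_cell (Suc n) w \<sigma>"
      by (auto simp: cells_def open_cell_def)
    show "\<sigma> \<in> insert n ` P \<union> N"
    proof (cases "n \<in> \<sigma>")
      case True
      then have "w n \<bullet> x > 0" "x \<in> open_cell n w (\<sigma> - {n})"
        using x(3) by (auto simp: open_cell_def dest: spec[of _ n])
      then have "\<sigma> - {n} \<in> P" using x by (auto simp: P_def less_Suc_eq)
      moreover have "\<sigma> = insert n (\<sigma> - {n})" using True by auto
      ultimately show ?thesis by blast
    next
      case False
      then have "w n \<bullet> x < 0" "x \<in> open_cell n w \<sigma>"
        using x(3) by (auto simp: open_cell_def dest: spec[of _ n])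
      then have "\<sigma> \<in> N" using x False by (auto simp: N_def less_Suc_eq)
      then show ?thesis by blast
    qed
  next
    fix \<sigma> assume "\<sigma> \<in> insert n ` P \<union> N"
    then show "\<sigma> \<in> cells (Suc n) w V"
    proof
      assume "\<sigma> \<in> insert n ` P"
      then obtain \<tau> x where t: "\<sigma> = insert n \<tau>" "\<tau> \<subseteq> {..<n}" "x \<in> V" "w n \<bullet> x > 0" "x \<in> open_cell n w \<tau>"
        by (auto simp: P_def)
      then show ?thesis
        by (auto simp: cells_def open_cell_def less_Suc_eq intro!: bexI[of _ x])
    next
      assume "\<sigma> \<in> N"
      then obtain x where t: "\<sigma> \<subseteq> {..<n}" "x \<in> V" "w n \<bullet> x < 0" "x \<in> open_cell n w \<sigma>"
        by (auto simp: N_def)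
      then have "n \<notin> \<sigma>" by auto
      with t show ?thesis
        by (auto simp: cells_def open_cell_def less_Suc_eq intro!: bexI[of _ x])
    qed
  qed
  have nP: "n \<notin> \<sigma>" if "\<sigma> \<in> P \<union> N" for \<sigma> using that by (auto simp: P_def N_def)
  have "card (cells (Suc n) w V) = card (insert n ` P) + card N"
    unfolding split by (intro card_Un_disjoint) (use fin nP in auto)
  also have "card (insert n ` P) = card P"
    using nP by (intro card_image inj_onI) (metis Diff_insert_absorb UnI1)
  also have "card P + card N = card (P \<union> N) + card (P \<inter> N)"
    by (rule card_Un_Int[OF fin])
  finally show ?thesis by (simp only: union inter)
qed

text \<open>Pascal's rule, summed. The bound on \<open>n\<close> matters: by truncation
  \<open>C_num 0 d\<close> and \<open>C_num 1 d\<close> coincide, and the recursion fails at n = 0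
  for positive d.\<close>

lemma C_num_Suc:
  assumes "n \<ge> 1"
  shows "C_num (Suc n) (Suc d) = C_num n (Suc d) + C_num n d"
proof -
  obtain k where k: "n = Suc k" using assms by (cases n) auto
  have "(\<Sum>r<Suc d. Suc k choose r) = (\<Sum>r<Suc d. k choose r) + (\<Sum>r<d. k choose r)"
    unfolding sum.lessThan_Suc_shift by (simp add: sum.distrib)
  then show ?thesis by (simp add: C_num_def k)
qed

text \<open>By \<open>card_cells_Suc\<close> the count obeys the recursion of \<open>C_num\<close>:
  restriction lowers the dimension by one and keeps general position. The induction starts at n = 1,
  where that recursion starts.\<close>

lemma card_cells:
  fixes w :: "nat \<Rightarrow> 'a::euclidean_space"
  assumes "subspace V" "gen_pos n w V" "n \<ge> 1"
  shows "card (cells n w V) = C_num n (dim V)"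
  using assms(3,1,2)
proof (induction n arbitrary: V rule: dec_induct)
  case base
  have zero: "card (cells 0 w U) = 1" if "subspace U" for U :: "'a set"
  proof -
    have "cells 0 w U = {{}}" using subspace_0[OF that] by (auto simp: cells_def)
    then show ?thesis by simp
  qed
  show ?case
  proof (cases "dim V")
    \<comment> \<open>On {0} every strict inequality fails, so there is no cell; this agrees with
      the empty sum in \<open>C_num\<close>.\<close>
    case 0
    then have "V \<subseteq> {0}" by (simp only: dim_eq_0)
    then have "w i \<bullet> x = 0" if "x \<in> V" for i x using that by auto
    then have "cells 1 w V = {}" by (auto simp: cells_def)
    with 0 show ?thesis by (simp add: C_num_def del: dim_eq_0)
  next
    case (Suc d)
    \<comment> \<open>In positive dimension the hyperplane must cut V properly, which gives the
      point off it that \<open>card_cells_Suc\<close> asks for.\<close>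
    have "dim (V \<inter> flat w {0}) < dim V"
      using base(2)[unfolded gen_pos_def, rule_format, of "{0}"] Suc by simp
    then have "\<not> V \<subseteq> flat w {0}" by (metis inf.absorb1 less_irrefl)
    then obtain z where z: "z \<in> V" "w 0 \<bullet> z \<noteq> 0" by (auto simp: flat_def)
    have "card (cells 1 w V) = 2"
      using card_cells_Suc[of V z w 0] base(1) z zero
      by (simp add: subspace_inter subspace_hyperplane)
    moreover have "C_num 1 (Suc d) = 2"
      unfolding C_num_def sum.lessThan_Suc_shift by simp
    ultimately show ?thesis using Suc by simp
  qed
next
  case (step n)
  show ?case
  proof (cases "dim V")
    case 0
    then have "V \<subseteq> {0}" by (simp only: dim_eq_0)
    then have "w i \<bullet> x = 0" if "x \<in> V" for i x using that by auto
    then have "cells (Suc n) w V = {}" by (auto simp: cells_def)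
    with 0 show ?thesis by (simp add: C_num_def del: dim_eq_0)
  next
    case (Suc d)
    have "dim (V \<inter> flat w {n}) < dim V"
      using step.prems(2)[unfolded gen_pos_def, rule_format, of "{n}"] Suc by simp
    then have "\<not> V \<subseteq> flat w {n}" by (metis inf.absorb1 less_irrefl)
    then obtain z where z: "z \<in> V" "w n \<bullet> z \<noteq> 0" by (auto simp: flat_def)
    have d: "dim (V \<inter> {x. w n \<bullet> x = 0}) = d"
      using dim_Int_hyperplane[OF step.prems(1) z] Suc by simp
    have "card (cells (Suc n) w V) = C_num n (dim V) + C_num n d"
      using card_cells_Suc[of V z w n] step.prems z d
        step.IH[OF step.prems(1) gen_pos_mono[OF step.prems(2)]]
        step.IH[OF _ gen_pos_Int_hyperplane[OF step.prems(2)]]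
      by (simp add: subspace_inter subspace_hyperplane)
    then show ?thesis using Suc C_num_Suc[OF step.hyps(1), of d] by simp
  qed
qed

text \<open>The hyperplanes through a point \<open>x \<noteq> 0\<close> have linearly independent normals, so \<open>x\<close> can be
  pushed off all of them to any prescribed sides.\<close>

lemma gen_pos_closed_cell_imp_cells:
  fixes w :: "nat \<Rightarrow> 'a::euclidean_space"
  assumes gp: "gen_pos n w UNIV" and \<rho>: "\<rho> \<subseteq> {..<n}" and x: "x \<in> closed_cell n w \<rho>" "x \<noteq> 0"
  shows "\<rho> \<in> cells n w UNIV"
proof -
  define J where "J = {i. i < n \<and> w i \<bullet> x = 0}"
  have J: "J \<subseteq> {..<n}" "finite J" by (auto simp: J_def)
  have dims: "dim (flat w I) = DIM('a) - card I" if "I \<subseteq> {..<n}" for I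
    using gp that by (simp add: gen_pos_def)
  \<comment> \<open>A nonzero point lies on fewer than d of the hyperplanes, so the subtractions
    below are not truncated.\<close>
  have "x \<in> flat w J" by (auto simp: flat_def J_def)
  with x(2) have "dim (flat w J) \<noteq> 0" by auto
  with dims[OF J(1)] have cJ: "card J < DIM('a)" by simp
  \<comment> \<open>A vector dual to \<open>w i\<close> within \<open>J\<close>: without one,
    omitting hyperplane i would not enlarge the flat, against the dimension formula.\<close>
  have "\<exists>z. z \<in> flat w (J - {i}) \<and> w i \<bullet> z \<noteq> 0" if i: "i \<in> J" for i
  proof (rule ccontr)
    assume "\<not> ?thesis"
    then have "flat w (J - {i}) \<subseteq> flat w J" by (auto simp: flat_def)
    from dim_subset[OF this] have "DIM('a) - card (J - {i}) \<le> DIM('a) - card J"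
      using dims[OF J(1)] dims[of "J - {i}"] J by (metis Diff_subset order_trans)
    moreover have "card J = Suc (card (J - {i}))" by (rule card.remove[OF J(2) i])
    ultimately show False using cJ by simp
  qed
  then have "\<forall>i\<in>J. \<exists>z. z \<in> flat w (J - {i}) \<and> w i \<bullet> z \<noteq> 0" by blast
  from bchoice[OF this] obtain z where
    z: "\<And>i. i \<in> J \<Longrightarrow> z i \<in> flat w (J - {i})" "\<And>i. i \<in> J \<Longrightarrow> w i \<bullet> z i \<noteq> 0"
    by blast
  define s :: "nat \<Rightarrow> real" where "s i = (if i \<in> \<rho> then 1 else -1)" for i
  \<comment> \<open>The dual vectors, rescaled and summed, prescribe the value +1 or -1 of each form
    in \<open>J\<close> independently.\<close>
  define y where "y = (\<Sum>i\<in>J. (s i / (w i \<bullet> z i)) *\<^sub>R z i)"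
  have y: "w j \<bullet> y = s j" if j: "j \<in> J" for j
  proof -
    have "w j \<bullet> y = (\<Sum>i\<in>J. if i = j then s j else 0)"
      unfolding y_def inner_sum_right
      by (rule sum.cong) (use z j in \<open>auto simp: flat_def\<close>)
    then show ?thesis using j J by simp
  qed
  have "if i \<in> \<rho> then w i \<bullet> x > 0 \<or> w i \<bullet> x = 0 \<and> w i \<bullet> y > 0
        else w i \<bullet> x < 0 \<or> w i \<bullet> x = 0 \<and> w i \<bullet> y < 0" if "i < n" for i
  proof (cases "i \<in> J")
    case True
    then show ?thesis using y[OF True] by (simp add: J_def s_def)
  next
    case False
    then have "w i \<bullet> x \<noteq> 0" using that by (simp add: J_def)
    then show ?thesis using x(1) that by (auto simp: closed_cell_def dest!: spec[of _ i])
  qed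
  from ex_perturb_cell[OF this] show ?thesis
    using \<rho> by (auto simp: cells_UNIV)
qed

section \<open>Joining two arrangements into one\<close>

definition join :: "nat \<Rightarrow> (nat \<Rightarrow> 'a) \<Rightarrow> (nat \<Rightarrow> 'a) \<Rightarrow> nat \<Rightarrow> 'a" where
  "join n u v = (\<lambda>i. if i < n then u i else v (i - n))"

text \<open>\<open>Q\<close> abstracts the sign condition, so that weak and strict inequalities are
  treated at once. The bound on \<sigma> keeps the two index blocks apart.\<close>

lemma all_less_join_iff:
  "(\<forall>i<n+m. Q (i \<in> \<sigma> \<union> (+) n ` \<tau>) (join n u v i)) \<longleftrightarrow>
   (\<forall>i<n. Q (i \<in> \<sigma>) (u i)) \<and> (\<forall>j<m. Q (j \<in> \<tau>) (v j))" if "\<sigma> \<subseteq> {..<n}"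
proof -
  have "(\<forall>i<n+m. R i) \<longleftrightarrow> (\<forall>i<n. R i) \<and> (\<forall>j<m. R (n + j))" for R :: "nat \<Rightarrow> bool"
    by (metis add_less_cancel_left le_add_diff_inverse not_le trans_less_add1)
  moreover have "i \<in> \<sigma> \<union> (+) n ` \<tau> \<longleftrightarrow> i \<in> \<sigma>" if "i < n" for i using that by auto
  moreover have "n + j \<in> \<sigma> \<union> (+) n ` \<tau> \<longleftrightarrow> j \<in> \<tau>" for j using \<open>\<sigma> \<subseteq> {..<n}\<close> by auto
  ultimately show ?thesis by (simp add: join_def)
qed

lemma closed_cell_join:
  assumes "\<sigma> \<subseteq> {..<n}"
  shows "closed_cell (n + m) (join n u v) (\<sigma> \<union> (+) n ` \<tau>) = closed_cell n u \<sigma> \<inter> closed_cell m v \<tau>"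
proof (rule set_eqI)
  fix x
  show "x \<in> closed_cell (n + m) (join n u v) (\<sigma> \<union> (+) n ` \<tau>) \<longleftrightarrow> x \<in> closed_cell n u \<sigma> \<inter> closed_cell m v \<tau>"
    using all_less_join_iff[OF assms, of m "\<lambda>b a. if b then a \<bullet> x \<ge> 0 else a \<bullet> x \<le> 0" \<tau> u v]
    by (simp only: closed_cell_def mem_Collect_eq Int_iff)
qed

lemma open_cell_join:
  assumes "\<sigma> \<subseteq> {..<n}"
  shows "open_cell (n + m) (join n u v) (\<sigma> \<union> (+) n ` \<tau>) = open_cell n u \<sigma> \<inter> open_cell m v \<tau>"
proof (rule set_eqI)
  fix x
  show "x \<in> open_cell (n + m) (join n u v) (\<sigma> \<union> (+) n ` \<tau>) \<longleftrightarrow> x \<in> open_cell n u \<sigma> \<inter> open_cell m v \<tau>"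
    using all_less_join_iff[OF assms, of m "\<lambda>b a. if b then a \<bullet> x > 0 else a \<bullet> x < 0" \<tau> u v]
    by (simp only: open_cell_def mem_Collect_eq Int_iff)
qed

text \<open>Concatenation of patterns is a bijection from meeting pairs onto joint cells. A nonzero
  common point lies in a closed joint cell, which general position makes a genuine cell; conversely
  a point of an open joint cell lies in both open cells.\<close>

lemma card_meeting_cells:
  fixes u v :: "nat \<Rightarrow> 'a::euclidean_space"
  assumes gp: "gen_pos (n + m) (join n u v) UNIV" and n: "n \<ge> 1"
  shows "card {(\<sigma>, \<tau>). \<sigma> \<in> cells n u UNIV \<and> \<tau> \<in> cells m v UNIV \<and>
        (\<exists>x. x \<noteq> 0 \<and> x \<in> closed_cell n u \<sigma> \<and> x \<in> closed_cell m v \<tau>)} = C_num (n + m) DIM('a)"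
    (is "card ?R = _")
proof -
  define f where "f = (\<lambda>(\<sigma>, \<tau>). \<sigma> \<union> (+) n ` \<tau>)"
  have sub: "fst p \<subseteq> {..<n}" "snd p \<subseteq> {..<m}" if "p \<in> ?R" for p
    using that by (auto simp: cells_def)
  have inj: "inj_on f ?R"
  proof (rule inj_on_inverseI)
    fix p assume "p \<in> ?R"
    from sub[OF this] show "(\<lambda>\<rho>. (\<rho> \<inter> {..<n}, {j. n + j \<in> \<rho>})) (f p) = p"
      by (auto simp: f_def split: prod.splits)
  qed
  have "f ` ?R = cells (n + m) (join n u v) UNIV"
  proof (intro equalityI subsetI)
    fix \<rho> assume "\<rho> \<in> f ` ?R"
    then obtain \<sigma> \<tau> x where st: "\<rho> = \<sigma> \<union> (+) n ` \<tau>" "\<sigma> \<subseteq> {..<n}" "\<tau> \<subseteq> {..<m}" "x \<noteq> 0"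
        "x \<in> closed_cell n u \<sigma>" "x \<in> closed_cell m v \<tau>"
      by (auto simp: f_def cells_def)
    then show "\<rho> \<in> cells (n + m) (join n u v) UNIV"
      by (intro gen_pos_closed_cell_imp_cells[OF gp, where x = x]) (auto simp: closed_cell_join)
  next
    fix \<rho> assume "\<rho> \<in> cells (n + m) (join n u v) UNIV"
    then obtain x where \<rho>: "\<rho> \<subseteq> {..<n+m}" and x: "x \<in> open_cell (n + m) (join n u v) \<rho>"
      by (auto simp: cells_UNIV)
    define \<sigma> \<tau> where "\<sigma> = \<rho> \<inter> {..<n}" and "\<tau> = {j. n + j \<in> \<rho>}"
    have st: "\<rho> = \<sigma> \<union> (+) n ` \<tau>"
    proof (intro equalityI subsetI)
      fix i assume "i \<in> \<rho>"
      then show "i \<in> \<sigma> \<union> (+) n ` \<tau>"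
        by (cases "i < n") (auto simp: \<sigma>_def \<tau>_def intro: image_eqI[of _ _ "i - n"])
    qed (auto simp: \<sigma>_def \<tau>_def)
    have s: "\<sigma> \<subseteq> {..<n}" by (simp add: \<sigma>_def)
    have t: "\<tau> \<subseteq> {..<m}"
    proof
      fix j assume "j \<in> \<tau>"
      then have "n + j \<in> {..<n + m}" using \<rho> by (intro subsetD[OF \<rho>]) (simp add: \<tau>_def)
      then show "j \<in> {..<m}" by simp
    qed
    have xo: "x \<in> open_cell n u \<sigma>" "x \<in> open_cell m v \<tau>"
      using x open_cell_join[OF s, of m u v \<tau>] unfolding st[symmetric] by simp_all
    \<comment> \<open>The strict inequality at index 0 excludes the origin.\<close>
    moreover have "x \<noteq> 0" using xo(1) n by (auto simp: open_cell_def dest!: spec[of _ 0] split: if_splits)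
    moreover have "x \<in> closed_cell n u \<sigma>" "x \<in> closed_cell m v \<tau>"
      using xo open_cell_subset_closed_cell by blast+
    ultimately have "(\<sigma>, \<tau>) \<in> ?R" using s t by (auto simp: cells_UNIV)
    moreover have "\<rho> = f (\<sigma>, \<tau>)" using st by (simp add: f_def)
    ultimately show "\<rho> \<in> f ` ?R" by (rule rev_image_eqI)
  qed
  then have "card ?R = card (cells (n + m) (join n u v) UNIV)"
    using card_image[OF inj] by simp
  then show ?thesis using card_cells[OF subspace_UNIV gp] n by simp
qed

text \<open>Each \<open>f (Suc r)\<close> covers the consecutive values \<open>g (Suc r)\<close> and
  \<open>g r\<close>. Descending from d - 1 in steps of two covers every r < d once; for odd d the
  last term is \<open>f 0 = g 0\<close>.\<close>

lemma sum_split_parity: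
  fixes f :: "nat \<Rightarrow> nat"
  assumes "f 0 = g 0" "\<And>r. f (Suc r) = g (Suc r) + g r" "d \<ge> 1"
  shows "(\<Sum>k\<le>(d - 1) div 2. f (d - 2 * k - 1)) = (\<Sum>r<d. g r)"
  using assms(3)
proof (induction d rule: less_induct)
  case (less d)
  consider "d = 1" | "d = 2" | "d \<ge> 3" using less.prems by linarith
  then show ?case
  proof cases
    case ge3: 3
    define d' where "d' = d - 2"
    have 3: "d = Suc (Suc d')" "d' \<ge> 1" using ge3 by (auto simp: d'_def)
    have "(\<Sum>k\<le>(d - 1) div 2. f (d - 2 * k - 1)) = (\<Sum>k\<le>Suc ((d' - 1) div 2). f (d - 2 * k - 1))"
      using 3 by (intro arg_cong[where f = "\<lambda>A. sum _ A"]) (cases d', auto)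
    also have "\<dots> = f (Suc d') + (\<Sum>k\<le>(d' - 1) div 2. f (d' - 2 * k - 1))"
      unfolding sum.atMost_Suc_shift by (simp add: 3)
    also have "\<dots> = (\<Sum>r<d. g r)"
      using less.IH[of d'] 3 assms(2)[of d'] by simp
    finally show ?thesis .
  qed (use assms(1) assms(2)[of 0] in \<open>auto simp: numeral_2_eq_2\<close>)
qed

lemma C_num_add:
  assumes "n \<ge> 1" "d \<ge> 1"
  shows "C_num (n + m) d =
    2 * (\<Sum>k\<le>(d - 1) div 2. \<Sum>p\<le>d - 2*k - 1. (n choose p) * (m choose (d - 2*k - 1 - p)))"
proof -
  obtain N where N: "n + m = Suc N" using assms(1) by (cases "n + m") auto
  \<comment> \<open>Here f is row n + m of Pascal's triangle and g the row before it, the one that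
    \<open>C_num\<close> uses.\<close>
  have "(\<Sum>k\<le>(d - 1) div 2. (n + m) choose (d - 2 * k - 1)) = (\<Sum>r<d. N choose r)"
    using assms(2) by (intro sum_split_parity) (simp_all add: N)
  then show ?thesis unfolding vandermonde by (simp add: C_num_def N)
qed

section \<open>Almost sure general position\<close>

lemma sets_sphere_uniform [measurable_cong]: "sets sphere_uniform = sets borel"
  by (simp add: sphere_uniform_def)

lemma prob_space_sphere_uniform: "prob_space (sphere_uniform :: 'a::euclidean_space measure)"
proof -
  have "emeasure lborel (ball 0 1 :: 'a set) \<noteq> 0"
    using open_not_negligible[of "ball 0 1 :: 'a set"]
    by (auto simp: negligible_iff_emeasure0)
  moreover have "emeasure lborel (ball 0 1 :: 'a set) \<noteq> \<infinity>"
    using emeasure_lborel_ball_finite[of "0::'a" 1] by simp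
  ultimately have "prob_space (uniform_measure lborel (ball 0 1 :: 'a set))"
    by (rule prob_space_uniform_measure)
  then show ?thesis
    unfolding sphere_uniform_def by (rule prob_space.prob_space_distr) simp
qed

text \<open>A subspace is invariant under scaling, so normalizing a nonzero vector neither enters
  nor leaves it, and a proper subspace is Lebesgue null.\<close>

lemma AE_sphere_uniform_notin_subspace:
  fixes V :: "'a::euclidean_space set"
  assumes V: "subspace V" "dim V < DIM('a)"
  shows "AE x in sphere_uniform. x \<notin> V"
proof -
  have [measurable]: "V \<in> sets borel"
    using closed_subspace[OF V(1)] by (rule borel_closed)
  have "V \<in> null_sets lebesgue"
    using negligible_lowdim[OF V(2)] by (simp add: negligible_iff_null_sets)
  then have "V \<in> null_sets lborel"
    by (subst (asm) null_sets_completion_iff) auto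
  then have "AE x in lborel. x \<notin> V" by (rule AE_not_in)
  then have "AE x in lborel. x \<in> ball 0 1 \<longrightarrow> x /\<^sub>R norm x \<notin> V"
  proof (rule eventually_mono)
    fix x assume "x \<notin> V"
    then show "x \<in> ball 0 1 \<longrightarrow> x /\<^sub>R norm x \<notin> V"
      using subspace_scale[OF V(1), of "x /\<^sub>R norm x" "norm x"] subspace_0[OF V(1)]
      by (cases "x = 0") auto
  qed
  then have "AE x in uniform_measure lborel (ball 0 1). x /\<^sub>R norm x \<notin> V"
    by (intro AE_uniform_measureI) simp_all
  then show ?thesis
    unfolding sphere_uniform_def by (subst AE_distr_iff) auto
qed

text \<open>Coefficients are indexed by \<open>J\<close> and not by the image, so \<open>v\<close>
  may repeat values.\<close>

lemma span_image_sum: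
  assumes "finite J" "b \<in> span (v ` J)"
  shows "\<exists>c. b = (\<Sum>j\<in>J. c j *\<^sub>R v j)"
  using assms
proof (induction J arbitrary: b rule: finite_induct)
  case (insert i J)
  then obtain k where "b - k *\<^sub>R v i \<in> span (v ` J)" by (auto simp: span_breakdown_eq)
  with insert.IH obtain c where c: "b - k *\<^sub>R v i = (\<Sum>j\<in>J. c j *\<^sub>R v j)" by blast
  have "(\<Sum>j\<in>J. (c(i := k)) j *\<^sub>R v j) = (\<Sum>j\<in>J. c j *\<^sub>R v j)"
    using insert.hyps by (intro sum.cong) auto
  then have "b = (\<Sum>j\<in>insert i J. (c(i := k)) j *\<^sub>R v j)"
    using insert.hyps c by (simp add: algebra_simps)
  then show ?case by blast
qed simp

lemma rational_combination_approx:
  fixes v :: "'i \<Rightarrow> 'a::real_normed_vector" and c :: "'i \<Rightarrow> real"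
  assumes "finite J" "e > 0"
  shows "\<exists>q\<in>PiE J (\<lambda>_. \<rat>). norm ((\<Sum>j\<in>J. c j *\<^sub>R v j) - (\<Sum>j\<in>J. q j *\<^sub>R v j)) < e"
proof -
  \<comment> \<open>The tolerance gives each summand an error of at most e / (card J + 1), so the
    total stays strictly below e. The added ones keep the denominators positive.\<close>
  define d where "d j = e / ((real (card J) + 1) * (norm (v j) + 1))" for j
  have pos: "(real (card J) + 1) * (norm (v j) + 1) > 0" for j
    by (intro mult_pos_pos add_nonneg_pos) auto
  then have d: "d j > 0" for j using assms(2) by (simp add: d_def)
  have "\<exists>r\<in>\<rat>. c j < r \<and> r < c j + d j" for j
    using Rats_dense_in_real[of "c j" "c j + d j"] d[of j] by simp
  then obtain r where r: "\<And>j. r j \<in> \<rat>" "\<And>j. c j < r j" "\<And>j. r j < c j + d j"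
    by metis
  define q where "q = restrict r J"
  have "norm ((\<Sum>j\<in>J. c j *\<^sub>R v j) - (\<Sum>j\<in>J. q j *\<^sub>R v j)) = norm (\<Sum>j\<in>J. (c j - r j) *\<^sub>R v j)"
    by (simp add: q_def sum_subtractf scaleR_diff_left)
  also have "\<dots> \<le> (\<Sum>j\<in>J. norm ((c j - r j) *\<^sub>R v j))" by (rule norm_sum)
  also have "\<dots> \<le> (\<Sum>j\<in>J. e / (real (card J) + 1))"
  proof (rule sum_mono)
    fix j
    have "\<bar>c j - r j\<bar> * norm (v j) \<le> d j * (norm (v j) + 1)"
      using r(2,3)[of j] by (intro mult_mono) auto
    also have "\<dots> = e / (real (card J) + 1)"
      using add_nonneg_pos[OF norm_ge_zero[of "v j"] zero_less_one] by (simp add: d_def)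
    finally show "norm ((c j - r j) *\<^sub>R v j) \<le> e / (real (card J) + 1)" by simp
  qed
  also have "\<dots> < e" using assms(2) by (simp add: field_simps)
  finally show ?thesis using r(1) by (intro bexI[of _ q]) (auto simp: q_def)
qed

lemma dim_span_Un_image_le:
  fixes U :: "'a::euclidean_space set"
  assumes "finite J"
  shows "dim (span (U \<union> v ` J)) \<le> dim U + card J"
proof -
  obtain B where B: "B \<subseteq> U" "independent B" "U \<subseteq> span B" "card B = dim U"
    using basis_exists by blast
  have fin: "finite B" using B(2) independent_imp_finite by blast
  have "span (U \<union> v ` J) \<subseteq> span (B \<union> v ` J)"
    using B(3) span_mono[of B "B \<union> v ` J"] by (intro span_minimal) (auto intro: span_base)
  then have "dim (span (U \<union> v ` J)) \<le> card (B \<union> v ` J)"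
    using fin assms by (intro dim_le_card) auto
  also have "\<dots> \<le> card B + card (v ` J)" by (rule card_Un_le)
  also have "\<dots> \<le> dim U + card J" using B(4) card_image_le[OF assms] by simp
  finally show ?thesis .
qed

lemma pred_countable_Bex:
  assumes "countable X" "\<And>i. i \<in> X \<Longrightarrow> Measurable.pred M (\<lambda>x. P x i)"
  shows "Measurable.pred M (\<lambda>x. \<exists>i\<in>X. P x i)"
  using assms unfolding pred_def by (intro sets.sets_Collect_countable_Ex') auto

text \<open>With all coordinates except i fixed, the span has dimension at most dim U + card J and
  is null for \<open>v i\<close>; Fubini does the rest. It is applied to a measurable set
  \<open>Bad\<close> that contains the event.\<close>

lemma AE_notin_span:
  fixes U :: "'a::euclidean_space set" and I :: "'i set"
  assumes I: "finite I" "i \<in> I" and J: "J \<subseteq> I - {i}" and d: "dim U + card J < DIM('a)"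
  shows "AE v in PiM I (\<lambda>_. sphere_uniform). v i \<notin> span (U \<union> v ` J)"
proof -
  let ?M = "sphere_uniform :: 'a measure"
  let ?P = "PiM I (\<lambda>_. ?M)"
  interpret prob_space ?M by (rule prob_space_sphere_uniform)
  interpret product_sigma_finite "\<lambda>_. ?M" ..
  have finJ: "finite J" using J I(1) finite_subset by blast
  obtain D where D: "countable D" "D \<subseteq> span U" "span U \<subseteq> closure D"
    using separable[of "span U"] by blast
  define Q where "Q = PiE J (\<lambda>_. \<rat> :: real set)"
  have Q: "countable Q" unfolding Q_def using finJ by (intro countable_PiE countable_rat)
  \<comment> \<open>Membership in the span, written with countable quantifiers only, to have a measurable event.\<close>
  define near where "near v l \<longleftrightarrow> (\<exists>t\<in>D. \<exists>c\<in>Q. norm (v i - (t + (\<Sum>j\<in>J. c j *\<^sub>R v j))) < inverse (real (Suc l)))"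
    for v :: "'i \<Rightarrow> 'a" and l :: nat
  define Bad where "Bad = {v \<in> space ?P. \<forall>l. near v l}"
  have comp [measurable]: "(\<lambda>v. v j) \<in> borel_measurable ?P" if "j \<in> I" for j
    using measurable_component_singleton[OF that, of "\<lambda>_. ?M"]
    by (simp cong: measurable_cong_sets add: sets_sphere_uniform)
  have [measurable]: "(\<lambda>v. v i) \<in> borel_measurable ?P" by (rule comp[OF I(2)])
  have sumJ [measurable]: "(\<lambda>v. \<Sum>j\<in>J. c j *\<^sub>R v j) \<in> borel_measurable ?P" for c
    using J by (intro borel_measurable_sum borel_measurable_scaleR borel_measurable_const comp) auto
  have [measurable]: "Measurable.pred ?P (\<lambda>v. near v l)" for l
    unfolding near_def by (intro pred_countable_Bex D Q) measurable
  have Bad [measurable]: "Bad \<in> sets ?P" unfolding Bad_def by measurable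
  \<comment> \<open>Subspaces are closed, so approximability to every order already means
    membership.\<close>
  have slice: "y \<in> span (U \<union> v ` J)" if "v(i := y) \<in> Bad" for v y
  proof -
    have "y \<in> closure (span (U \<union> v ` J))"
      unfolding closure_approachable
    proof (intro allI impI)
      fix e :: real assume "e > 0"
      then obtain l where l: "inverse (real (Suc l)) < e" using reals_Archimedean by blast
      have "near (v(i := y)) l" using that by (simp add: Bad_def)
      then obtain t c where tc: "t \<in> D"
        "norm (y - (t + (\<Sum>j\<in>J. c j *\<^sub>R (v(i := y)) j))) < inverse (real (Suc l))"
        unfolding near_def fun_upd_same by blast
      have eq: "(\<Sum>j\<in>J. c j *\<^sub>R (v(i := y)) j) = (\<Sum>j\<in>J. c j *\<^sub>R v j)"
        using J by (intro sum.cong) auto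
      have "t \<in> span (U \<union> v ` J)" using tc(1) D(2) span_mono[of U "U \<union> v ` J"] by blast
      moreover have "(\<Sum>j\<in>J. c j *\<^sub>R v j) \<in> span (U \<union> v ` J)"
        by (intro span_sum span_scale span_base) auto
      ultimately have "t + (\<Sum>j\<in>J. c j *\<^sub>R v j) \<in> span (U \<union> v ` J)" by (rule span_add)
      moreover have "dist (t + (\<Sum>j\<in>J. c j *\<^sub>R v j)) y < e"
        using tc(2) l unfolding eq by (simp add: dist_norm norm_minus_commute)
      ultimately show "\<exists>z\<in>span (U \<union> v ` J). dist z y < e" by blast
    qed
    then show ?thesis by simp
  qed
  have "emeasure ?P Bad = (\<integral>\<^sup>+v. indicator Bad v \<partial>PiM (insert i (I - {i})) (\<lambda>_. ?M))"
    using I by (simp add: insert_absorb)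
  also have "\<dots> = (\<integral>\<^sup>+v. (\<integral>\<^sup>+y. indicator Bad (v(i := y)) \<partial>?M) \<partial>PiM (I - {i}) (\<lambda>_. ?M))"
    using I by (intro product_nn_integral_insert) (auto simp: insert_absorb)
  also have "\<dots> = (\<integral>\<^sup>+v. (\<integral>\<^sup>+y. 0 \<partial>?M) \<partial>PiM (I - {i}) (\<lambda>_. ?M))"
  proof (rule nn_integral_cong, rule nn_integral_cong_AE)
    fix v
    have "dim (span (U \<union> v ` J)) < DIM('a)"
      using dim_span_Un_image_le[OF finJ, of U v] d by linarith
    from AE_sphere_uniform_notin_subspace[OF subspace_span this]
    show "AE y in ?M. indicator Bad (v(i := y)) = (0::ennreal)"
      by (rule eventually_mono) (use slice in \<open>auto simp: indicator_def\<close>)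
  qed
  finally have "emeasure ?P Bad = 0" by simp
  then have "Bad \<in> null_sets ?P" using Bad by auto
  \<comment> \<open>The inclusion of the event in \<open>Bad\<close>: the error is halved between
    the part in \<open>span U\<close> and the coefficients on \<open>J\<close>.\<close>
  moreover have "v \<in> Bad" if v: "v \<in> space ?P" "v i \<in> span (U \<union> v ` J)" for v
  proof -
    obtain a b where ab: "a \<in> span U" "b \<in> span (v ` J)" "v i = a + b"
      using v(2) by (auto simp: span_Un)
    obtain c where c: "b = (\<Sum>j\<in>J. c j *\<^sub>R v j)" using span_image_sum[OF finJ ab(2)] by blast
    have "near v l" for l
    proof -
      let ?e = "inverse (real (Suc l)) / 2"
      have e: "?e > 0" by simp
      have "a \<in> closure D" using ab(1) D(3) by blast
      then obtain t where t: "t \<in> D" "dist t a < ?e"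
        using e unfolding closure_approachable by blast
      obtain q where q: "q \<in> Q" "norm (b - (\<Sum>j\<in>J. q j *\<^sub>R v j)) < ?e"
        using rational_combination_approx[OF finJ e, of c v] unfolding c Q_def by blast
      have "norm (v i - (t + (\<Sum>j\<in>J. q j *\<^sub>R v j))) = norm ((a - t) + (b - (\<Sum>j\<in>J. q j *\<^sub>R v j)))"
        by (simp add: ab(3) algebra_simps)
      also have "\<dots> \<le> norm (a - t) + norm (b - (\<Sum>j\<in>J. q j *\<^sub>R v j))" by (rule norm_triangle_ineq)
      also have "\<dots> < inverse (real (Suc l))"
        using t(2) q(2) by (simp add: dist_norm norm_minus_commute)
      finally show ?thesis unfolding near_def using t(1) q(1) by blast
    qed
    then show ?thesis using v(1) by (auto simp: Bad_def)
  qed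
  ultimately show ?thesis by (intro AE_I'[of Bad]) auto
qed

lemma AE_gen_pos:
  "AE w in PiM {..<n} (\<lambda>_. sphere_uniform :: 'a::euclidean_space measure). gen_pos n w UNIV"
proof -
  have "AE w in PiM {..<n} (\<lambda>_. sphere_uniform :: 'a measure).
      \<forall>i\<in>{..<n}. \<forall>J\<in>{J. J \<subseteq> {..<i} \<and> card J < DIM('a)}. w i \<notin> span ({} \<union> w ` J)"
    by (intro AE_finite_allI AE_notin_span) auto
  then show ?thesis
    by (rule eventually_mono) (intro gen_posI, auto)
qed

lemma AE_gen_pos_join:
  "AE u in PiM {..<n} (\<lambda>_. sphere_uniform :: 'a::euclidean_space measure).
   AE v in PiM {..<m} (\<lambda>_. sphere_uniform). gen_pos (n + m) (join n u v) UNIV"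
proof -
  have "AE u in PiM {..<n} (\<lambda>_. sphere_uniform :: 'a measure).
      \<forall>i\<in>{..<n}. \<forall>J\<in>{J. J \<subseteq> {..<i} \<and> card J < DIM('a)}. u i \<notin> span ({} \<union> u ` J)"
    by (intro AE_finite_allI AE_notin_span) auto
  then show ?thesis
  proof (rule eventually_mono)
    fix u :: "nat \<Rightarrow> 'a"
    assume u: "\<forall>i\<in>{..<n}. \<forall>J\<in>{J. J \<subseteq> {..<i} \<and> card J < DIM('a)}. u i \<notin> span ({} \<union> u ` J)"
    have dim: "dim (u ` A) \<le> card A" if "finite A" for A
      using dim_le_card'[of "u ` A"] card_image_le[OF that, of u] that by simp
    have "AE v in PiM {..<m} (\<lambda>_. sphere_uniform :: 'a measure).
        \<forall>A\<in>Pow {..<n}. \<forall>i\<in>{..<m}. \<forall>J\<in>{J. J \<subseteq> {..<i} \<and> card A + card J < DIM('a)}. v i \<notin> span (u ` A \<union> v ` J)"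
    proof (intro AE_finite_allI AE_notin_span)
      fix A i J assume "A \<in> Pow {..<n}" "J \<in> {J. J \<subseteq> {..<i} \<and> card A + card J < DIM('a)}"
      then show "dim (u ` A) + card J < DIM('a)"
        using dim[of A] finite_subset[of A "{..<n}"] by auto
    qed auto
    then show "AE v in PiM {..<m} (\<lambda>_. sphere_uniform). gen_pos (n + m) (join n u v) UNIV"
    proof (rule eventually_mono)
      fix v :: "nat \<Rightarrow> 'a"
      assume v: "\<forall>A\<in>Pow {..<n}. \<forall>i\<in>{..<m}. \<forall>J\<in>{J. J \<subseteq> {..<i} \<and> card A + card J < DIM('a)}. v i \<notin> span (u ` A \<union> v ` J)"
      show "gen_pos (n + m) (join n u v) UNIV"
      proof (rule gen_posI)
        fix i K assume i: "i < n + m" and K: "K \<subseteq> {..<i}" "card K < DIM('a)"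
        show "join n u v i \<notin> span (join n u v ` K)"
        proof (cases "i < n")
          case True
          then have "join n u v ` K = u ` K"
            using K(1) by (intro image_cong) (auto simp: join_def)
          then show ?thesis using True u K by (simp add: join_def)
        next
          case False
          define A where "A = K \<inter> {..<n}"
          define J where "J = {j. n + j \<in> K}"
          have K_eq: "K = A \<union> (+) n ` J"
          proof (intro equalityI subsetI)
            fix k assume "k \<in> K"
            then show "k \<in> A \<union> (+) n ` J"
              by (cases "k < n") (auto simp: A_def J_def intro: image_eqI[of _ _ "k - n"])
          qed (auto simp: A_def J_def)
          have J: "J \<subseteq> {..<i - n}"
          proof
            fix j assume "j \<in> J"
            then have "n + j < i" using K(1) by (auto simp: J_def)
            then show "j \<in> {..<i - n}" by simp
          qed
          then have fin: "finite A" "finite J" by (auto simp: A_def intro: finite_subset)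
          have "card K = card A + card ((+) n ` J)"
            unfolding K_eq by (rule card_Un_disjoint) (use fin in \<open>auto simp: A_def\<close>)
          also have "card ((+) n ` J) = card J" by (rule card_image) simp
          finally have card: "card A + card J < DIM('a)" using K(2) by simp
          have "join n u v ` K = join n u v ` A \<union> (\<lambda>j. join n u v (n + j)) ` J"
            by (simp only: K_eq image_Un image_image)
          also have "join n u v ` A = u ` A" by (intro image_cong) (auto simp: join_def A_def)
          also have "(\<lambda>j. join n u v (n + j)) ` J = v ` J" by (simp add: join_def)
          finally have "join n u v ` K = u ` A \<union> v ` J" .
          moreover have "v (i - n) \<notin> span (u ` A \<union> v ` J)"
            using v[rule_format, of A "i - n" J] False i J card by (auto simp: A_def)
          ultimately show ?thesis using False by (simp add: join_def)
        qed
      qed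
    qed
  qed
qed

section \<open>Measurability\<close>

text \<open>Since the Bochner integral of a non-measurable function is \<open>0\<close>, it is not enough to know
  the integrand almost everywhere: it has to be measurable on degenerate configurations too.\<close>

lemma pred_mem_cells:
  fixes f :: "'b \<Rightarrow> nat \<Rightarrow> 'a::euclidean_space"
  assumes [measurable]: "\<And>i. i < n \<Longrightarrow> (\<lambda>x. f x i) \<in> borel_measurable M"
  shows "Measurable.pred M (\<lambda>x. \<sigma> \<in> cells n (f x) UNIV)"
proof -
  obtain D :: "'a set" where D: "countable D" "\<And>X. open X \<Longrightarrow> X \<noteq> {} \<Longrightarrow> \<exists>d\<in>D. d \<in> X"
    using countable_dense_setE by blast
  have "\<sigma> \<in> cells n w UNIV \<longleftrightarrow> \<sigma> \<subseteq> {..<n} \<and>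
      (\<exists>y\<in>D. \<forall>i\<in>{..<n}. if i \<in> \<sigma> then w i \<bullet> y > 0 else w i \<bullet> y < 0)" for w :: "nat \<Rightarrow> 'a"
  proof -
    \<comment> \<open>Openness lets a fixed countable dense set detect nonempty cells.\<close>
    have "open_cell n w \<sigma> \<noteq> {} \<longleftrightarrow> (\<exists>y\<in>D. y \<in> open_cell n w \<sigma>)"
      using D(2)[OF open_open_cell[of n w \<sigma>]] by blast
    then show ?thesis
      by (simp only: cells_UNIV mem_Collect_eq) (simp only: open_cell_def mem_Collect_eq Ball_def lessThan_iff)
  qed
  then show ?thesis
    by (simp only:) (intro pred_intros_logic pred_countable_Bex[OF D(1)], measurable)
qed

text \<open>A closed cell may have empty interior, so a dense set need not meet it. After
  normalization to the unit sphere, the inequalities are relaxed by 1/(l+1): the relaxed sets are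
  open and thus seen by a countable dense subset of the sphere, and compactness recovers an exact
  solution as l grows.\<close>

lemma pred_closed_cell_nontrivial:
  fixes f :: "'b \<Rightarrow> nat \<Rightarrow> 'a::euclidean_space"
  assumes [measurable]: "\<And>i. i < n \<Longrightarrow> (\<lambda>x. f x i) \<in> borel_measurable M"
  shows "Measurable.pred M (\<lambda>x. \<exists>y. y \<noteq> 0 \<and> y \<in> closed_cell n (f x) \<sigma>)"
proof -
  obtain D :: "'a set" where D: "countable D" "D \<subseteq> sphere 0 1" "sphere 0 1 \<subseteq> closure D"
    using separable by blast
  define near where "near w l y \<longleftrightarrow>
    (\<forall>i\<in>{..<n}. if i \<in> \<sigma> then w i \<bullet> y > - inverse (real (Suc l)) else w i \<bullet> y < inverse (real (Suc l)))"
    for w :: "nat \<Rightarrow> 'a" and l y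
  have "(\<exists>y. y \<noteq> 0 \<and> y \<in> closed_cell n w \<sigma>) \<longleftrightarrow> (\<forall>l. \<exists>y\<in>D. near w l y)" for w :: "nat \<Rightarrow> 'a"
  proof
    assume "\<exists>y. y \<noteq> 0 \<and> y \<in> closed_cell n w \<sigma>"
    then obtain y0 where y0: "y0 \<noteq> 0" "y0 \<in> closed_cell n w \<sigma>" by blast
    define y where "y = y0 /\<^sub>R norm y0"
    have ys: "y \<in> sphere 0 1" using y0(1) by (simp add: y_def)
    have yc: "if i \<in> \<sigma> then w i \<bullet> y \<ge> 0 else w i \<bullet> y \<le> 0" if "i < n" for i
      using y0(2) that by (auto simp: closed_cell_def y_def mult_le_0_iff zero_le_mult_iff)
    show "\<forall>l. \<exists>y\<in>D. near w l y"
    proof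
      fix l
      define X where "X = {y. near w l y}"
      have "X = (\<Inter>i\<in>{..<n}. if i \<in> \<sigma> then {y. w i \<bullet> y > - inverse (real (Suc l))}
                              else {y. w i \<bullet> y < inverse (real (Suc l))})"
        by (auto simp: X_def near_def split: if_splits)
      then have "open X"
        by (simp only:) (intro open_INT, auto simp: open_halfspace_lt open_halfspace_gt)
      moreover have "y \<in> X"
        unfolding X_def near_def
      proof (intro CollectI ballI)
        fix i assume "i \<in> {..<n}"
        moreover have "inverse (real (Suc l)) > 0" by simp
        ultimately show "if i \<in> \<sigma> then w i \<bullet> y > - inverse (real (Suc l)) else w i \<bullet> y < inverse (real (Suc l))"
          using yc[of i] unfolding lessThan_iff by (auto simp del: inverse_positive_iff_positive of_nat_Suc split: if_splits)
      qed
      ultimately have "X \<inter> D \<noteq> {}"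
        using open_Int_closure_eq_empty[of X D] ys D(3) by blast
      then show "\<exists>y\<in>D. near w l y" by (auto simp: X_def)
    qed
  next
    assume "\<forall>l. \<exists>y\<in>D. near w l y"
    then obtain y where y: "\<And>l. y l \<in> D" "\<And>l. near w l (y l)" by metis
    have "\<forall>l. y l \<in> sphere 0 1" using y(1) D(2) by blast
    then obtain z r where z: "z \<in> sphere 0 1" "strict_mono r" "(y \<circ> r) \<longlonglongrightarrow> z"
      using compact_sphere[of "0::'a" 1] unfolding compact_def by meson
    have lim0: "(\<lambda>k. inverse (real (Suc (r k)))) \<longlonglongrightarrow> 0"
      using LIMSEQ_subseq_LIMSEQ[OF LIMSEQ_inverse_real_of_nat z(2)] by (simp add: o_def)
    have limw: "(\<lambda>k. w i \<bullet> y (r k)) \<longlonglongrightarrow> w i \<bullet> z" for i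
      using tendsto_inner[OF tendsto_const z(3), of "w i"] by (simp add: o_def)
    have "z \<in> closed_cell n w \<sigma>"
      unfolding closed_cell_def
    proof (intro CollectI allI impI)
      fix i assume i: "i < n"
      show "if i \<in> \<sigma> then w i \<bullet> z \<ge> 0 else w i \<bullet> z \<le> 0"
      proof (cases "i \<in> \<sigma>")
        case True
        have "- inverse (real (Suc (r k))) \<le> w i \<bullet> y (r k)" for k
          using y(2)[of "r k", unfolded near_def, rule_format, of i] i True by (simp del: of_nat_Suc)
        then have "- 0 \<le> w i \<bullet> z"
          by (intro LIMSEQ_le[OF tendsto_minus[OF lim0] limw]) blast
        with True show ?thesis by simp
      next
        case False
        have "w i \<bullet> y (r k) \<le> inverse (real (Suc (r k)))" for k
          using y(2)[of "r k", unfolded near_def, rule_format, of i] i False by (simp del: of_nat_Suc)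
        then have "w i \<bullet> z \<le> 0"
          by (intro LIMSEQ_le[OF limw lim0]) blast
        with False show ?thesis by simp
      qed
    qed
    moreover have "z \<noteq> 0" using z(1) by auto
    ultimately show "\<exists>y. y \<noteq> 0 \<and> y \<in> closed_cell n w \<sigma>" by blast
  qed
  moreover have "Measurable.pred M (\<lambda>x. \<forall>l. \<exists>y\<in>D. near (f x) l y)"
    unfolding near_def
    by (intro pred_intros_countable(1) pred_countable_Bex[OF D(1)]) measurable
  ultimately show ?thesis by simp
qed

lemma borel_measurable_card_Collect:
  assumes "finite A" and [measurable]: "\<And>p. p \<in> A \<Longrightarrow> Measurable.pred M (\<lambda>x. Q x p)"
  shows "(\<lambda>x. real (card {p \<in> A. Q x p})) \<in> borel_measurable M"
proof -
  have "real (card {p \<in> A. Q x p}) = (\<Sum>p\<in>A. if Q x p then 1 else 0)" for x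
    using assms(1) by (simp add: sum.If_cases Int_def conj_commute)
  then show ?thesis
    by (simp only:) (intro borel_measurable_sum, measurable)
qed

lemma borel_measurable_card_cells:
  fixes f :: "'b \<Rightarrow> nat \<Rightarrow> 'a::euclidean_space"
  assumes "\<And>i. i < n \<Longrightarrow> (\<lambda>x. f x i) \<in> borel_measurable M"
  shows "(\<lambda>x. real (card (cells n (f x) UNIV))) \<in> borel_measurable M"
proof -
  have "cells n w UNIV = {\<sigma> \<in> Pow {..<n}. \<sigma> \<in> cells n w UNIV}" for w :: "nat \<Rightarrow> 'a"
    by (auto simp: cells_def)
  then have "(\<lambda>x. real (card (cells n (f x) UNIV))) = (\<lambda>x. real (card {\<sigma> \<in> Pow {..<n}. \<sigma> \<in> cells n (f x) UNIV}))"
    by simp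
  also have "\<dots> \<in> borel_measurable M"
    by (intro borel_measurable_card_Collect pred_mem_cells assms) auto
  finally show ?thesis .
qed

lemma borel_measurable_card_meeting_cells:
  fixes f g :: "'b \<Rightarrow> nat \<Rightarrow> 'a::euclidean_space"
  assumes f: "\<And>i. i < n \<Longrightarrow> (\<lambda>x. f x i) \<in> borel_measurable M"
    and g: "\<And>i. i < m \<Longrightarrow> (\<lambda>x. g x i) \<in> borel_measurable M"
  shows "(\<lambda>x. real (card {(\<sigma>, \<tau>). \<sigma> \<in> cells n (f x) UNIV \<and> \<tau> \<in> cells m (g x) UNIV \<and>
        (\<exists>y. y \<noteq> 0 \<and> y \<in> closed_cell n (f x) \<sigma> \<and> y \<in> closed_cell m (g x) \<tau>)})) \<in> borel_measurable M"
proof -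
  \<comment> \<open>Through \<open>join\<close>, the two closed cells become one closed cell, to
    which \<open>pred_closed_cell_nontrivial\<close> applies.\<close>
  define Q where "Q x p \<longleftrightarrow> fst p \<in> cells n (f x) UNIV \<and> snd p \<in> cells m (g x) UNIV \<and>
    (\<exists>y. y \<noteq> 0 \<and> y \<in> closed_cell (n + m) (join n (f x) (g x)) (fst p \<union> (+) n ` snd p))" for x p
  have eq: "{(\<sigma>, \<tau>). \<sigma> \<in> cells n (f x) UNIV \<and> \<tau> \<in> cells m (g x) UNIV \<and>
        (\<exists>y. y \<noteq> 0 \<and> y \<in> closed_cell n (f x) \<sigma> \<and> y \<in> closed_cell m (g x) \<tau>)}
      = {p \<in> Pow {..<n} \<times> Pow {..<m}. Q x p}" for x
  proof -
    have "\<sigma> \<subseteq> {..<n}" if "\<sigma> \<in> cells n (f x) UNIV" for \<sigma> using that by (simp add: cells_def)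
    moreover have "\<tau> \<subseteq> {..<m}" if "\<tau> \<in> cells m (g x) UNIV" for \<tau> using that by (simp add: cells_def)
    ultimately show ?thesis by (auto simp: Q_def closed_cell_join)
  qed
  have j: "(\<lambda>x. join n (f x) (g x) i) \<in> borel_measurable M" if "i < n + m" for i
    using that f g by (cases "i < n") (auto simp: join_def)
  show ?thesis
    unfolding eq Q_def
    by (intro borel_measurable_card_Collect pred_intros_logic pred_mem_cells
        pred_closed_cell_nontrivial f g j) auto
qed

section \<open>The intersection probability\<close>

theorem theorem1p4:
  fixes n m :: nat
  assumes "DIM('a::euclidean_space) \<ge> 2" and "n \<ge> 1" and "m \<ge> 1"
  shows "schlaefli_intersection_prob TYPE('a) n m =
    2 / (real (C_num n DIM('a)) * real (C_num m DIM('a))) *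
    (\<Sum>k\<le>(DIM('a) - 1) div 2. \<Sum>p\<le>DIM('a) - 2*k - 1.
        real ((n choose p) * (m choose (DIM('a) - 2*k - 1 - p))))"
proof -
  let ?P = "\<lambda>k::nat. PiM {..<k} (\<lambda>_. sphere_uniform :: 'a measure)"
  interpret P: prob_space "?P k" for k
    by (intro prob_space_PiM prob_space_sphere_uniform)
  define F where "F u v =
     real (card {(\<sigma>, \<tau>). \<sigma> \<in> cells n u UNIV \<and> \<tau> \<in> cells m v UNIV \<and>
        (\<exists>x. x \<noteq> 0 \<and> x \<in> closed_cell n u \<sigma> \<and> x \<in> closed_cell m v \<tau>)})
     / (real (card (cells n u UNIV)) * real (card (cells m v UNIV)))" for u v :: "nat \<Rightarrow> 'a"
  define c where "c = real (C_num (n + m) DIM('a)) / (real (C_num n DIM('a)) * real (C_num m DIM('a)))"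
  have comp: "(\<lambda>w. w i) \<in> borel_measurable (?P k)" if "i < k" for i k
    using measurable_component_singleton[of i "{..<k}" "\<lambda>_. sphere_uniform :: 'a measure"] that
    by (simp cong: measurable_cong_sets add: sets_sphere_uniform)
  \<comment> \<open>Joint measurability is what makes the inner integral a measurable function of
    \<open>u\<close>.\<close>
  have "(\<lambda>p. F (fst p) (snd p)) \<in> borel_measurable (?P n \<Otimes>\<^sub>M ?P m)"
    unfolding F_def
    by (intro borel_measurable_divide borel_measurable_times borel_measurable_card_meeting_cells
        borel_measurable_card_cells measurable_compose[OF measurable_fst comp]
        measurable_compose[OF measurable_snd comp])
  then have meas: "(\<lambda>(u, v). F u v) \<in> borel_measurable (?P n \<Otimes>\<^sub>M ?P m)"
    by (simp add: case_prod_beta')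
  have AE_F: "AE u in ?P n. AE v in ?P m. F u v = c"
    using AE_gen_pos_join[of n m] AE_gen_pos[of n]
  proof eventually_elim
    case (elim u)
    show ?case using elim(1) AE_gen_pos[of m]
    proof eventually_elim
      case (elim v)
      then show ?case using \<open>gen_pos n u UNIV\<close> assms
        by (simp add: F_def c_def card_meeting_cells card_cells)
    qed
  qed
  \<comment> \<open>The inner integral is evaluated only for those \<open>u\<close> whose
    exceptional set is null, which is almost every \<open>u\<close>.\<close>
  have inner: "(\<integral>v. F u v \<partial>?P m) = c" if "u \<in> space (?P n)" "AE v in ?P m. F u v = c" for u
  proof -
    have "(\<integral>v. F u v \<partial>?P m) = (\<integral>v. c \<partial>?P m)"
      using measurable_compose[OF measurable_Pair1'[OF that(1)] meas] that(2)
      by (intro integral_cong_AE) auto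
    then show ?thesis by (simp add: P.prob_space)
  qed
  have "schlaefli_intersection_prob TYPE('a) n m = (\<integral>u. (\<integral>v. F u v \<partial>?P m) \<partial>?P n)"
    unfolding schlaefli_intersection_prob_def F_def card_meeting_pairs card_schlaefli_cones ..
  also have "\<dots> = (\<integral>u. c \<partial>?P n)"
  proof (rule integral_cong_AE)
    show "(\<lambda>u. \<integral>v. F u v \<partial>?P m) \<in> borel_measurable (?P n)"
      by (rule P.borel_measurable_lebesgue_integral) (rule meas)
    show "AE u in ?P n. (\<integral>v. F u v \<partial>?P m) = c"
      using AE_F AE_space by eventually_elim (rule inner)
  qed simp
  also have "\<dots> = c" by (simp add: P.prob_space)
  finally show ?thesis
    using assms by (simp add: c_def C_num_add)
qed

end
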